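(* Let $0<p\leq 1$, let $N\geq 1$ be an integer, and let $\Psi:\mathbb{R}^N\to\mathbb{R}^N$ and $\Xi=\Psi^{-1}:\mathbb{R}^N\to\mathbb{R}^N$ be the componentwise maps $\Psi(u)_i=\operatorname{sgn}(u_i)|u_i|^{p/2}$ and $\Xi(v)_i=\operatorname{sgn}(v_i)|v_i|^{2/p}$ for $i=1,\dots,N$. Let $J:\mathbb{R}^N\to\mathbb{R}$ be a function and put $\tilde{J}=J\circ\Xi:\mathbb{R}^N\to\mathbb{R}$ (so that $J=\tilde{J}\circ\Psi$). If $u^*\in\mathbb{R}^N$ is a local minimizer of $J$, then $\Psi(u^* )$ is a local minimizer of $\tilde{J}$. Similarly, if $v^*\in\mathbb{R}^N$ is a local minimizer of $\tilde{J}$, then $\Xi(v^* )$ is a local minimizer of $J$.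
   Context: The sign function is $\operatorname{sgn}(x)=1$ for $x>0$, $\operatorname{sgn}(0)=0$, and $\operatorname{sgn}(x)=-1$ for $x<0$. A point $u^*\in\mathbb{R}^N$ is a local minimizer of $J:\mathbb{R}^N\to\mathbb{R}$ if there is a neighborhood $\mathcal{N}$ of $u^*$ such that $J(u^* )\leq J(w)$ for all $w\in\mathcal{N}$. *)

theory Defs
  imports "HOL-Analysis.Analysis"
begin

definition local_minimizer :: "('a::topological_space \<Rightarrow> real) \<Rightarrow> 'a \<Rightarrow> bool" where
  "local_minimizer J u \<longleftrightarrow> (\<exists>S. u \<in> interior S \<and> (\<forall>w\<in>S. J u \<le> J w))"

text \<open>At a zero component, \<open>0 powr a = 0\<close> agrees with the usual value
  of \<open>0\<close> raised to a positive exponent.\<close>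

definition Psi :: "real \<Rightarrow> real^'n \<Rightarrow> real^'n" where
  "Psi p u = (\<chi> i. sgn (u $ i) * \<bar>u $ i\<bar> powr (p / 2))"

definition Xi :: "real \<Rightarrow> real^'n \<Rightarrow> real^'n" where
  "Xi p v = (\<chi> i. sgn (v $ i) * \<bar>v $ i\<bar> powr (2 / p))"

lemma sgn_powr_cancel:
  fixes x a b :: real
  assumes "a * b = 1"
  shows "sgn (sgn x * \<bar>x\<bar> powr a) * \<bar>sgn x * \<bar>x\<bar> powr a\<bar> powr b = x"
  using assms by (cases "x = 0") (auto simp: sgn_mult abs_mult powr_powr sgn_if)

lemma Xi_Psi: "p > 0 \<Longrightarrow> Xi p (Psi p u) = u"
  by (simp add: vec_eq_iff Xi_def Psi_def sgn_powr_cancel)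

lemma Psi_Xi: "p > 0 \<Longrightarrow> Psi p (Xi p v) = v"
  by (simp add: vec_eq_iff Xi_def Psi_def sgn_powr_cancel)

lemma bij_Psi: "p > 0 \<Longrightarrow> bij (Psi p)"
  by (rule o_bij[where g = "Xi p"]) (auto simp: fun_eq_iff Xi_Psi Psi_Xi)

lemma Xi_eq_inv_Psi: "p > 0 \<Longrightarrow> Xi p = inv (Psi p)"
  by (rule inv_unique_comp[symmetric]) (auto simp: fun_eq_iff Xi_Psi Psi_Xi)

lemma comp_Xi_Psi: "p > 0 \<Longrightarrow> (J \<circ> Xi p) \<circ> Psi p = J"
  by (simp add: fun_eq_iff Xi_Psi)

end

theory Submission
  imports Defs
begin

text \<open>Being a local minimizer is preserved by precomposition with a map \<open>g\<close> that is merely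
  continuous at the point: the preimage under \<open>g\<close> of a neighbourhood on which \<open>J\<close> is minimal at
  \<open>g v\<close> is a neighbourhood of \<open>v\<close> on which \<open>J \<circ> g\<close> is minimal at \<open>v\<close>
  (\<open>local_minimizer_comp\<close>). Applied to \<open>J\<close> and \<open>\<Xi>\<close> this gives the first claim, and applied to
  \<open>J \<circ> \<Xi>\<close> and \<open>\<Psi>\<close> the second, because \<open>J = (J \<circ> \<Xi>) \<circ> \<Psi>\<close>. What remains is that \<open>\<Psi>\<close> and \<open>\<Xi>\<close> are
  continuous. Both act on each component by a signed power with positive exponent, and such a
  power is continuous even at \<open>0\<close>, where \<open>sgn\<close> jumps (\<open>isCont_signed_powr\<close>).\<close>

text \<open>Splitting into the powers of the positive and the negative part of \<open>x\<close> removes the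
  discontinuous factor \<open>sgn x\<close>. A power with positive exponent is continuous on the nonnegative
  reals, including \<open>0\<close>.\<close>

lemma isCont_signed_powr:
  fixes a x :: real
  assumes "a > 0"
  shows "isCont (\<lambda>x. sgn x * \<bar>x\<bar> powr a) x"
proof -
  have split: "(\<lambda>x::real. sgn x * \<bar>x\<bar> powr a) = (\<lambda>x. max x 0 powr a - max (- x) 0 powr a)"
    by (auto simp: fun_eq_iff sgn_if max_def)
  have "continuous_on UNIV (\<lambda>x::real. max x 0 powr a - max (- x) 0 powr a)"
    using assms by (intro continuous_intros continuous_on_powr') auto
  then show ?thesis
    unfolding split by (simp add: continuous_on_eq_continuous_at)
qed

lemma isCont_componentwise:
  fixes f :: "real \<Rightarrow> real" and u :: "real^'n"
  assumes "\<And>x. isCont f x"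
  shows "isCont (\<lambda>u::real^'n. \<chi> i. f (u $ i)) u"
  unfolding isCont_def
  by (intro tendsto_vec_lambda isCont_tendsto_compose[OF assms] tendsto_vec_nth tendsto_ident_at)

lemma isCont_Psi:
  assumes "p > 0"
  shows "isCont (Psi p) u"
  unfolding Psi_def using assms by (intro isCont_componentwise isCont_signed_powr) simp

lemma isCont_Xi:
  assumes "p > 0"
  shows "isCont (Xi p) v"
  unfolding Xi_def using assms by (intro isCont_componentwise isCont_signed_powr) simp

lemma local_minimizer_comp:
  assumes "local_minimizer J (g v)" and "isCont g v"
  shows "local_minimizer (J \<circ> g) v"
proof -
  obtain S where S: "g v \<in> interior S" "\<forall>w\<in>S. J (g v) \<le> J w"
    using assms(1) unfolding local_minimizer_def by blast
  obtain T where T: "open T" "v \<in> T" "\<forall>w\<in>T. g w \<in> interior S"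
    using assms(2) S(1) unfolding continuous_at_open by (metis open_interior)
  have "J (g v) \<le> J (g w)" if "w \<in> T" for w
    using that S(2) T(3) interior_subset by blast
  then show ?thesis
    unfolding local_minimizer_def using T(1,2) by (intro exI[of _ T]) (simp add: interior_open)
qed

theorem theorem1:
  fixes p :: real
    and J Jt :: "real^'n \<Rightarrow> real"
  assumes "0 < p" and "p \<le> 1"
    and "Jt = J \<circ> Xi p"
  shows "(\<forall>u. local_minimizer J u \<longrightarrow> local_minimizer Jt (Psi p u)) \<and>
         (\<forall>v. local_minimizer Jt v \<longrightarrow> local_minimizer J (Xi p v))"
proof (intro conjI allI impI)
  fix u assume "local_minimizer J u"
  then have "local_minimizer J (Xi p (Psi p u))"
    using assms(1) by (simp add: Xi_Psi)
  then show "local_minimizer Jt (Psi p u)"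
    unfolding assms(3) by (rule local_minimizer_comp[OF _ isCont_Xi[OF assms(1)]])
next
  fix v assume "local_minimizer Jt v"
  then have "local_minimizer Jt (Psi p (Xi p v))"
    using assms(1) by (simp add: Psi_Xi)
  then have "local_minimizer (Jt \<circ> Psi p) (Xi p v)"
    by (rule local_minimizer_comp[OF _ isCont_Psi[OF assms(1)]])
  then show "local_minimizer J (Xi p v)"
    unfolding assms(3) using comp_Xi_Psi[OF assms(1)] by metis
qed

end
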